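(* Let $R=(G,\Phi,\Phi^+)$ be a faithful signed groupoid set. Assume that $R$ is finite, complete and preprincipal. Then $R^\Box$ is also finite, complete and preprincipal.
   Context: For a groupoid $G$, ${}_aG_b$ is the set of morphisms $b\to a$, ${}_aG$ the set of morphisms with codomain $a$, $1_a$ the identity at $a$; $fg$ means first $g$, then $f$. A definitely involuted set is a set $E$ with a fixed-point-free involution $x\mapsto -x$ and a subset $E^+$ such that $E=E^+\sqcup E^-$, $E^-:=-E^+$. A signed groupoid set $R=(G,\Phi,\Phi^+)$ is a groupoid $G$ with a family of definitely involuted sets ${}_a\Phi$ (positive part ${}_a\Phi^+$), $a\in\mathrm{Ob}(G)$, and maps ${}_aG_b\times{}_b\Phi\to{}_a\Phi$ with $1_b(x)=x$, $f(g(x))=(fg)(x)$, $f(-x)=-f(x)$ (positivity need not be preserved). $R$ is finite if $G$ has finitely many morphisms and all ${}_a\Phi$ are finite. For $g\in{}_aG_b$, $\Phi_g:=\{\alpha\in{}_a\Phi^+\mid g^{-1}(\alpha)\in{}_b\Phi^-\}$. $R$ is faithful if $\Phi_g=\emptyset$ implies $g$ is an identity. For faithful $R$, the weak order at $a$ is the partial order on ${}_aG$ with $g\le h\iff\Phi_g\subseteq\Phi_h$. $R$ is complete if every weak order is a complete lattice. A morphism $g\in{}_aG$ is atomic if it is an atom of the weak order at $a$. $R$ is interval finite if $\{h\in{}_aG\mid h\le g\}$ is finite for all $a$ and $g\in{}_aG$. $R$ is preprincipal if it is faithful, interval finite, and for all $g,s\in{}_aG$ with $s$ atomic either $\Phi_s\subseteq\Phi_g$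 or $\Phi_s\cap\Phi_g=\emptyset$. For faithful $R$, a square is a quadruple $(x,w,y,z)$ of morphisms $w\colon a\to b$, $x\colon b\to d$, $z\colon a\to c$, $y\colon c\to d$ with $xw=yz$ and $x(\Phi_w)=\Phi_y$. The groupoid $G^\Box$ has objects $(a,X)$ with $a\in\mathrm{Ob}(G)$, $X\subseteq{}_aG$; a morphism $(a,X)\to(b,Y)$ is a morphism $f\colon a\to b$ of $G$ for which there is a bijection $\sigma_f\colon X\to Y$ such that $(f,g,\sigma_f(g),\sigma_f(g)^{-1}fg)$ is a square for all $g\in X$ (equivalently $f(\Phi_g)=\Phi_{\sigma_f(g)}$ for all $g\in X$); composition is as in $G$. $R^\Box=(G^\Box,\Psi,\Psi^+)$ with ${}_{(a,X)}\Psi={}_a\Phi$, ${}_{(a,X)}\Psi^+={}_a\Phi^+$ and action inherited from $G$; it is a faithful signed groupoid set. *)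

theory Defs
  imports "HOL-Algebra.Complete_Lattice"
begin

section \<open>Groupoids\<close>

text \<open>
  A groupoid is given by a set of objects and a single set of morphisms with domain and codomain
  maps. Composition is only meaningful for composable morphisms, and
  \<open>f \<cdot>\<^bsub>G\<^esub> g\<close> means: first \<open>g\<close>, then \<open>f\<close>.
\<close>

record ('o, 'm) groupoid =
  Ob :: "'o set"
  Mor :: "'m set"
  Dom :: "'m \<Rightarrow> 'o"
  Cod :: "'m \<Rightarrow> 'o"
  Comp :: "'m \<Rightarrow> 'm \<Rightarrow> 'm"  (infixl \<open>\<cdot>\<index>\<close> 70)
  Ident :: "'o \<Rightarrow> 'm"
  Inv :: "'m \<Rightarrow> 'm"

text \<open>
  \<open>Hom G a b\<close> is the set \<open>\<^sub>aG\<^sub>b\<close> of morphisms from \<open>b\<close> to \<open>a\<close> (codomain first), and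
  \<open>Star G a\<close> is the set \<open>\<^sub>aG\<close> of morphisms with codomain \<open>a\<close>.
\<close>

definition Hom :: "('o, 'm, 'z) groupoid_scheme \<Rightarrow> 'o \<Rightarrow> 'o \<Rightarrow> 'm set" where
  "Hom G a b = {f \<in> Mor G. Cod G f = a \<and> Dom G f = b}"

definition Star :: "('o, 'm, 'z) groupoid_scheme \<Rightarrow> 'o \<Rightarrow> 'm set" where
  "Star G a = {f \<in> Mor G. Cod G f = a}"

locale groupoid =
  fixes G :: "('o, 'm, 'z) groupoid_scheme" (structure)
  assumes Dom_closed: "f \<in> Mor G \<Longrightarrow> Dom G f \<in> Ob G"
    and Cod_closed: "f \<in> Mor G \<Longrightarrow> Cod G f \<in> Ob G"
    and Ident_closed: "a \<in> Ob G \<Longrightarrow> Ident G a \<in> Hom G a a"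
    and Comp_closed: "\<lbrakk>f \<in> Hom G a b; g \<in> Hom G b c\<rbrakk> \<Longrightarrow> f \<cdot> g \<in> Hom G a c"
    and Inv_closed: "f \<in> Hom G a b \<Longrightarrow> Inv G f \<in> Hom G b a"
    and Comp_assoc: "\<lbrakk>f \<in> Hom G a b; g \<in> Hom G b c; h \<in> Hom G c d\<rbrakk>
                      \<Longrightarrow> (f \<cdot> g) \<cdot> h = f \<cdot> (g \<cdot> h)"
    and Ident_left: "f \<in> Hom G a b \<Longrightarrow> Ident G a \<cdot> f = f"
    and Ident_right: "f \<in> Hom G a b \<Longrightarrow> f \<cdot> Ident G b = f"
    and Inv_left: "f \<in> Hom G a b \<Longrightarrow> Inv G f \<cdot> f = Ident G b"
    and Inv_right: "f \<in> Hom G a b \<Longrightarrow> f \<cdot> Inv G f = Ident G a"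

section \<open>Signed groupoid sets\<close>

locale definitely_involuted_set =
  fixes E :: "'r set" and neg :: "'r \<Rightarrow> 'r" and P :: "'r set"
  assumes neg_closed: "x \<in> E \<Longrightarrow> neg x \<in> E"
    and neg_neg: "x \<in> E \<Longrightarrow> neg (neg x) = x"
    and neg_no_fixpoint: "x \<in> E \<Longrightarrow> neg x \<noteq> x"
    and pos_un_neg: "E = P \<union> neg ` P"
    and pos_int_neg: "P \<inter> neg ` P = {}"

text \<open>
  The root sets at different objects need not be disjoint, so negation depends on the object; the
  action of \<open>f\<close> is only meaningful on \<open>Phi R (Dom R f)\<close>. No axiom relates the action to
  \<open>Phi_pos\<close>.
\<close>

record ('o, 'm, 'r) sgs = "('o, 'm) groupoid" +
  Phi :: "'o \<Rightarrow> 'r set"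
  Phi_pos :: "'o \<Rightarrow> 'r set"
  Neg :: "'o \<Rightarrow> 'r \<Rightarrow> 'r"
  Act :: "'m \<Rightarrow> 'r \<Rightarrow> 'r"

definition Phi_neg :: "('o, 'm, 'r, 'z) sgs_scheme \<Rightarrow> 'o \<Rightarrow> 'r set" where
  "Phi_neg R a = Neg R a ` Phi_pos R a"

locale signed_groupoid_set = groupoid R
  for R :: "('o, 'm, 'r, 'z) sgs_scheme" (structure) +
  assumes Phi_involuted: "a \<in> Ob R \<Longrightarrow> definitely_involuted_set (Phi R a) (Neg R a) (Phi_pos R a)"
    and Act_closed: "\<lbrakk>f \<in> Hom R a b; x \<in> Phi R b\<rbrakk> \<Longrightarrow> Act R f x \<in> Phi R a"
    and Act_Ident: "\<lbrakk>b \<in> Ob R; x \<in> Phi R b\<rbrakk> \<Longrightarrow> Act R (Ident R b) x = x"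
    and Act_Comp: "\<lbrakk>f \<in> Hom R a b; g \<in> Hom R b c; x \<in> Phi R c\<rbrakk>
                    \<Longrightarrow> Act R f (Act R g x) = Act R (f \<cdot> g) x"
    and Act_Neg: "\<lbrakk>f \<in> Hom R a b; x \<in> Phi R b\<rbrakk> \<Longrightarrow> Act R f (Neg R b x) = Neg R a (Act R f x)"

locale finite_sgs = signed_groupoid_set R
  for R :: "('o, 'm, 'r, 'z) sgs_scheme" (structure) +
  assumes finite_Mor: "finite (Mor R)"
    and finite_Phi: "a \<in> Ob R \<Longrightarrow> finite (Phi R a)"

text \<open>
  \<open>inv_set R g\<close> is the set \<open>\<Phi>\<^sub>g\<close>; it lives at the codomain of \<open>g\<close>.
\<close>

definition inv_set :: "('o, 'm, 'r, 'z) sgs_scheme \<Rightarrow> 'm \<Rightarrow> 'r set" where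
  "inv_set R g = {\<alpha> \<in> Phi_pos R (Cod R g). Act R (Inv R g) \<alpha> \<in> Phi_neg R (Dom R g)}"

locale faithful_sgs = signed_groupoid_set R
  for R :: "('o, 'm, 'r, 'z) sgs_scheme" (structure) +
  assumes faithful: "\<lbrakk>g \<in> Mor R; inv_set R g = {}\<rbrakk> \<Longrightarrow> \<exists>a \<in> Ob R. g = Ident R a"

section \<open>Weak orders\<close>

definition weak_order :: "('o, 'm, 'r, 'z) sgs_scheme \<Rightarrow> 'o \<Rightarrow> 'm gorder" where
  "weak_order R a = \<lparr>carrier = Star R a, eq = (=), le = (\<lambda>g h. inv_set R g \<subseteq> inv_set R h)\<rparr>"

locale complete_sgs = faithful_sgs R
  for R :: "('o, 'm, 'r, 'z) sgs_scheme" (structure) +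
  assumes weak_order_complete: "a \<in> Ob R \<Longrightarrow> complete_lattice (weak_order R a)"

definition atom :: "('a, 'z) gorder_scheme \<Rightarrow> 'a \<Rightarrow> bool" where
  "atom L s \<longleftrightarrow> s \<in> carrier L \<and>
     (\<exists>b. least L b (carrier L) \<and> s \<noteq> b \<and>
          (\<forall>y \<in> carrier L. y \<sqsubseteq>\<^bsub>L\<^esub> s \<longrightarrow> y = b \<or> y = s))"

definition atomic :: "('o, 'm, 'r, 'z) sgs_scheme \<Rightarrow> 'm \<Rightarrow> bool" where
  "atomic R g \<longleftrightarrow> g \<in> Mor R \<and> atom (weak_order R (Cod R g)) g"

definition interval_finite :: "('o, 'm, 'r, 'z) sgs_scheme \<Rightarrow> bool" where
  "interval_finite R \<longleftrightarrow>
     (\<forall>a \<in> Ob R. \<forall>g \<in> Star R a. finite {h \<in> Star R a. h \<sqsubseteq>\<^bsub>weak_order R a\<^esub> g})"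

locale preprincipal_sgs = faithful_sgs R
  for R :: "('o, 'm, 'r, 'z) sgs_scheme" (structure) +
  assumes interval_finite: "interval_finite R"
    and atomic_dichotomy: "\<lbrakk>a \<in> Ob R; g \<in> Star R a; s \<in> Star R a; atomic R s\<rbrakk>
      \<Longrightarrow> inv_set R s \<subseteq> inv_set R g \<or> inv_set R s \<inter> inv_set R g = {}"

section \<open>Squares\<close>

text \<open>
  The quadruple \<open>(x, w, y, z)\<close> with \<open>w : a \<rightarrow> b\<close>, \<open>x : b \<rightarrow> d\<close>, \<open>z : a \<rightarrow> c\<close>,
  \<open>y : c \<rightarrow> d\<close>.
\<close>

definition square :: "('o, 'm, 'r, 'z) sgs_scheme \<Rightarrow> 'm \<Rightarrow> 'm \<Rightarrow> 'm \<Rightarrow> 'm \<Rightarrow> bool" where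
  "square R x w y z \<longleftrightarrow>
     (\<exists>a b c d. w \<in> Hom R b a \<and> x \<in> Hom R d b \<and> z \<in> Hom R c a \<and> y \<in> Hom R d c) \<and>
     x \<cdot>\<^bsub>R\<^esub> w = y \<cdot>\<^bsub>R\<^esub> z \<and> Act R x ` inv_set R w = inv_set R y"

definition box_Ob :: "('o, 'm, 'r, 'z) sgs_scheme \<Rightarrow> ('o \<times> 'm set) set" where
  "box_Ob R = {(a, X). a \<in> Ob R \<and> X \<subseteq> Star R a}"

text \<open>As for \<open>Hom\<close>, the codomain comes first: \<open>box_hom R B A\<close> contains the
  morphisms from \<open>A\<close> to \<open>B\<close>.\<close>

definition box_hom ::
  "('o, 'm, 'r, 'z) sgs_scheme \<Rightarrow> 'o \<times> 'm set \<Rightarrow> 'o \<times> 'm set \<Rightarrow> 'm set" where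
  "box_hom R B A = {f \<in> Hom R (fst B) (fst A).
     \<exists>\<sigma>. bij_betw \<sigma> (snd A) (snd B) \<and>
         (\<forall>g \<in> snd A. square R f g (\<sigma> g) (Inv R (\<sigma> g) \<cdot>\<^bsub>R\<^esub> f \<cdot>\<^bsub>R\<^esub> g))}"

text \<open>
  As the same \<open>f\<close> can be a morphism between several pairs of objects of the box groupoid, a
  morphism \<open>A \<rightarrow> B\<close> is represented there as the triple \<open>(B, f, A)\<close>.
\<close>

definition box_sgs :: "('o, 'm, 'r, 'z) sgs_scheme \<Rightarrow>
    ('o \<times> 'm set, ('o \<times> 'm set) \<times> 'm \<times> ('o \<times> 'm set), 'r) sgs" where
  "box_sgs R = \<lparr>
     Ob = box_Ob R,
     Mor = {(B, f, A). A \<in> box_Ob R \<and> B \<in> box_Ob R \<and> f \<in> box_hom R B A},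
     Dom = (\<lambda>(B, f, A). A),
     Cod = (\<lambda>(B, f, A). B),
     Comp = (\<lambda>(C, f, B) (B', g, A). (C, f \<cdot>\<^bsub>R\<^esub> g, A)),
     Ident = (\<lambda>(a, X). ((a, X), Ident R a, (a, X))),
     Inv = (\<lambda>(B, f, A). (A, Inv R f, B)),
     Phi = (\<lambda>(a, X). Phi R a),
     Phi_pos = (\<lambda>(a, X). Phi_pos R a),
     Neg = (\<lambda>(a, X). Neg R a),
     Act = (\<lambda>(B, f, A). Act R f)\<rparr>"

end

theory Submission
  imports Defs
begin

text \<open>
  Comparing \<open>g\<close> with \<open>g \<cdot> w\<close>, where \<open>w\<close> is the greatest element of the weak order at the domain of \<open>g\<close>,
  shows that complete weak orders have complements: \<open>\<Phi>\<^sub>g\<close> removed from the greatest inversion set is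
  again an inversion set. Hence \<open>\<Phi>\<^sub>f \<inter> \<Phi>\<^sub>g = {}\<close> is a bound \<open>f \<le> g'\<close>, and disjointness from \<open>g\<close> is
  inherited by joins. The weak order of the box at \<open>(b, Y)\<close> consists of those \<open>f\<close> for which, for all
  \<open>y \<in> Y\<close>, the sets \<open>\<Phi>\<^sub>f\<close> and \<open>\<Phi>\<^sub>y\<close> are disjoint and their union is an inversion set; it is closed
  under joins, so the box is complete and has complements itself.

  Let \<open>s\<close> be an atom of the box at \<open>(b, Y)\<close>, and \<open>r \<le> s\<close> an atom of \<open>R\<close>. Two elements of the box
  above \<open>r\<close> have a meet in the box which is again above \<open>r\<close>, so every element above \<open>r\<close> is above
  \<open>s\<close>. Given \<open>g\<close>, either \<open>r\<close> is below \<open>g\<close> or it is disjoint from \<open>g\<close> and then below the complement of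
  \<open>g\<close> in the box; accordingly \<open>s\<close> is below \<open>g\<close> or disjoint from it.
\<close>

section \<open>Groupoids\<close>

lemma Star_iff_Hom: "f \<in> Star G a \<longleftrightarrow> f \<in> Hom G a (Dom G f)"
  by (auto simp: Star_def Hom_def)

lemma Hom_imp_Star: "f \<in> Hom G a b \<Longrightarrow> f \<in> Star G a"
  by (auto simp: Star_def Hom_def)

lemma Hom_DomD: "f \<in> Hom G a b \<Longrightarrow> Dom G f = b"
  and Hom_CodD: "f \<in> Hom G a b \<Longrightarrow> Cod G f = a"
  by (auto simp: Hom_def)

context groupoid
begin

lemma Hom_Ob: "f \<in> Hom G a b \<Longrightarrow> a \<in> Ob G \<and> b \<in> Ob G"
  using Dom_closed Cod_closed by (auto simp: Hom_def)

lemma Comp_Inv_cancel: "\<lbrakk>f \<in> Hom G a b; h \<in> Hom G a c\<rbrakk> \<Longrightarrow> f \<cdot> (Inv G f \<cdot> h) = h"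
  by (simp add: Comp_assoc[OF _ Inv_closed, symmetric] Inv_right Ident_left)

lemma Inv_Comp_cancel: "\<lbrakk>f \<in> Hom G a b; h \<in> Hom G b c\<rbrakk> \<Longrightarrow> Inv G f \<cdot> (f \<cdot> h) = h"
  by (simp add: Comp_assoc[OF Inv_closed, symmetric] Inv_left Ident_left)

lemma Inv_unique:
  assumes f: "f \<in> Hom G a b" and g: "g \<in> Hom G b a" and eq: "f \<cdot> g = Ident G a"
  shows "Inv G f = g"
  using Inv_Comp_cancel[OF f g] Ident_right[OF Inv_closed[OF f]] eq by simp

lemma Inv_Inv: "f \<in> Hom G a b \<Longrightarrow> Inv G (Inv G f) = f"
  by (rule Inv_unique[OF Inv_closed _ Inv_left])

lemma Inv_Comp:
  assumes f: "f \<in> Hom G a b" and g: "g \<in> Hom G b c"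
  shows "Inv G (f \<cdot> g) = Inv G g \<cdot> Inv G f"
proof (rule Inv_unique[OF Comp_closed[OF f g] Comp_closed[OF Inv_closed[OF g] Inv_closed[OF f]]])
  show "f \<cdot> g \<cdot> (Inv G g \<cdot> Inv G f) = Ident G a"
    using Comp_assoc[OF f g Comp_closed[OF Inv_closed[OF g] Inv_closed[OF f]]]
      Comp_Inv_cancel[OF g Inv_closed[OF f]] Inv_right[OF f] by simp
qed

lemma Inv_Ident: "a \<in> Ob G \<Longrightarrow> Inv G (Ident G a) = Ident G a"
  by (rule Inv_unique[OF Ident_closed Ident_closed Ident_left[OF Ident_closed]])

end

section \<open>Sign-closed inversion sets\<close>

text \<open>
  The sign-closed inversion set \<open>\<Phi>\<^sub>g \<union> -\<Phi>\<^sub>g\<close> carries the same information as \<open>\<Phi>\<^sub>g\<close>, but turns the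
  cocycle property into an exclusive disjunction without any positivity side conditions.
\<close>

definition sinv_set :: "('o, 'm, 'r, 'z) sgs_scheme \<Rightarrow> 'm \<Rightarrow> 'r set" where
  "sinv_set R g = {\<alpha> \<in> Phi R (Cod R g).
     (\<alpha> \<in> Phi_pos R (Cod R g)) \<noteq> (Act R (Inv R g) \<alpha> \<in> Phi_pos R (Dom R g))}"

context signed_groupoid_set
begin

lemma Act_Inv_Act: "\<lbrakk>f \<in> Hom R a b; x \<in> Phi R b\<rbrakk> \<Longrightarrow> Act R (Inv R f) (Act R f x) = x"
  by (metis Act_Comp Act_Ident Hom_Ob Inv_closed Inv_left)

lemma Act_Act_Inv: "\<lbrakk>f \<in> Hom R a b; x \<in> Phi R a\<rbrakk> \<Longrightarrow> Act R f (Act R (Inv R f) x) = x"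
  by (metis Act_Comp Act_Ident Hom_Ob Inv_closed Inv_right)

lemma Phi_pos_subset: "a \<in> Ob R \<Longrightarrow> Phi_pos R a \<subseteq> Phi R a"
  using definitely_involuted_set.pos_un_neg[OF Phi_involuted] by blast

lemma Neg_closed: "\<lbrakk>a \<in> Ob R; x \<in> Phi R a\<rbrakk> \<Longrightarrow> Neg R a x \<in> Phi R a"
  by (rule definitely_involuted_set.neg_closed[OF Phi_involuted])

lemma Neg_Neg: "\<lbrakk>a \<in> Ob R; x \<in> Phi R a\<rbrakk> \<Longrightarrow> Neg R a (Neg R a x) = x"
  by (rule definitely_involuted_set.neg_neg[OF Phi_involuted])

lemma Phi_neg_iff:
  assumes "a \<in> Ob R"
  shows "x \<in> Phi_neg R a \<longleftrightarrow> x \<in> Phi R a \<and> x \<notin> Phi_pos R a"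
proof -
  interpret definitely_involuted_set "Phi R a" "Neg R a" "Phi_pos R a"
    using Phi_involuted[OF assms] .
  show ?thesis
    using pos_un_neg pos_int_neg unfolding Phi_neg_def by blast
qed

lemma Neg_pos_iff:
  assumes "a \<in> Ob R" "x \<in> Phi R a"
  shows "Neg R a x \<in> Phi_pos R a \<longleftrightarrow> x \<notin> Phi_pos R a"
proof -
  have "Neg R a x \<in> Phi_neg R a \<longleftrightarrow> x \<in> Phi_pos R a"
    unfolding Phi_neg_def using Neg_Neg assms Phi_pos_subset by (auto simp: image_iff) (metis subsetD)
  then show ?thesis
    using Phi_neg_iff[OF assms(1)] Neg_closed[OF assms] by blast
qed

lemma sinv_set_subset_Phi: "f \<in> Star R a \<Longrightarrow> sinv_set R f \<subseteq> Phi R a"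
  by (auto simp: sinv_set_def Star_def)

lemma inv_set_eq:
  assumes "f \<in> Star R a"
  shows "inv_set R f = sinv_set R f \<inter> Phi_pos R a"
proof -
  have f: "f \<in> Hom R a (Dom R f)"
    using assms by (simp add: Star_iff_Hom)
  note ob = Hom_Ob[OF f]
  show ?thesis
    using Phi_pos_subset[OF conjunct1[OF ob]] Act_closed[OF Inv_closed[OF f]]
    by (auto simp: inv_set_def sinv_set_def Hom_CodD[OF f] Phi_neg_iff[OF conjunct2[OF ob]])
qed

text \<open>Negation commutes with the action and flips the sign at both ends, so the exclusive
  disjunction in \<open>sinv_set\<close> does not notice it.\<close>

lemma Neg_sinv_set_iff:
  assumes f: "f \<in> Star R a" and x: "x \<in> Phi R a"
  shows "Neg R a x \<in> sinv_set R f \<longleftrightarrow> x \<in> sinv_set R f"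
proof -
  have h: "f \<in> Hom R a (Dom R f)"
    using f by (simp add: Star_iff_Hom)
  note ob = Hom_Ob[OF h]
  show ?thesis
    using ob x Neg_closed[of a x] Act_closed[OF Inv_closed[OF h] x]
    by (auto simp: sinv_set_def Hom_CodD[OF h] Act_Neg[OF Inv_closed[OF h] x] Neg_pos_iff)
qed

text \<open>Exactly one of a root and its negative is positive, so a set stable under negation is
  determined by its positive part. This carries the weak order, and disjointness in the same way,
  over to \<open>sinv_set\<close>.\<close>

lemma inv_set_subset_iff:
  assumes f: "f \<in> Star R a" and g: "g \<in> Star R a"
  shows "inv_set R f \<subseteq> inv_set R g \<longleftrightarrow> sinv_set R f \<subseteq> sinv_set R g"
proof
  assume sub: "inv_set R f \<subseteq> inv_set R g"
  have ob: "a \<in> Ob R"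
    using Hom_Ob f Star_iff_Hom by metis
  show "sinv_set R f \<subseteq> sinv_set R g"
  proof
    fix x assume x: "x \<in> sinv_set R f"
    then have xp: "x \<in> Phi R a"
      using sinv_set_subset_Phi[OF f] by blast
    show "x \<in> sinv_set R g"
    proof (cases "x \<in> Phi_pos R a")
      case True
      then show ?thesis
        using x sub inv_set_eq[OF f] inv_set_eq[OF g] by blast
    next
      case False
      then have "Neg R a x \<in> inv_set R f"
        using x inv_set_eq[OF f] Neg_sinv_set_iff[OF f xp] Neg_pos_iff[OF ob xp] by blast
      then show ?thesis
        using sub inv_set_eq[OF g] Neg_sinv_set_iff[OF g xp] by blast
    qed
  qed
qed (use inv_set_eq[OF f] inv_set_eq[OF g] in blast)

lemma inv_set_disjoint_iff:
  assumes f: "f \<in> Star R a" and g: "g \<in> Star R a"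
  shows "inv_set R f \<inter> inv_set R g = {} \<longleftrightarrow> sinv_set R f \<inter> sinv_set R g = {}"
proof
  assume dis: "inv_set R f \<inter> inv_set R g = {}"
  have ob: "a \<in> Ob R"
    using Hom_Ob f Star_iff_Hom by metis
  have False if x: "x \<in> sinv_set R f" "x \<in> sinv_set R g" for x
  proof -
    have xp: "x \<in> Phi R a"
      using x sinv_set_subset_Phi[OF f] by blast
    have "x \<notin> Phi_pos R a" "Neg R a x \<notin> Phi_pos R a"
      using dis x inv_set_eq[OF f] inv_set_eq[OF g] Neg_sinv_set_iff[OF f xp]
        Neg_sinv_set_iff[OF g xp] by blast+
    then show False
      using Neg_pos_iff[OF ob xp] by blast
  qed
  then show "sinv_set R f \<inter> sinv_set R g = {}"
    by blast
qed (use inv_set_eq[OF f] inv_set_eq[OF g] in blast)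

text \<open>The cocycle rule: the inverse of \<open>f \<cdot> g\<close> acts in two steps, and the
  total sign changes iff exactly one of the steps changes it.\<close>

lemma sinv_set_Comp_iff:
  assumes f: "f \<in> Hom R a b" and g: "g \<in> Hom R b c" and x: "x \<in> Phi R a"
  shows "x \<in> sinv_set R (f \<cdot> g) \<longleftrightarrow> (x \<in> sinv_set R f) \<noteq> (Act R (Inv R f) x \<in> sinv_set R g)"
proof -
  have "Act R (Inv R (f \<cdot> g)) x = Act R (Inv R g) (Act R (Inv R f) x)"
    using Inv_Comp[OF f g] Act_Comp[OF Inv_closed[OF g] Inv_closed[OF f] x] by simp
  then show ?thesis
    using x Act_closed[OF Inv_closed[OF f] x]
    by (auto simp: sinv_set_def Hom_CodD[OF f] Hom_DomD[OF f] Hom_CodD[OF g] Hom_DomD[OF g]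
        Hom_CodD[OF Comp_closed[OF f g]] Hom_DomD[OF Comp_closed[OF f g]])
qed

lemma sinv_set_Inv_iff:
  assumes f: "f \<in> Hom R a b" and x: "x \<in> Phi R b"
  shows "x \<in> sinv_set R (Inv R f) \<longleftrightarrow> Act R f x \<in> sinv_set R f"
  using x Act_closed[OF f x] Act_Inv_Act[OF f x]
  by (auto simp: sinv_set_def Hom_CodD[OF f] Hom_DomD[OF f] Inv_Inv[OF f]
      Hom_CodD[OF Inv_closed[OF f]] Hom_DomD[OF Inv_closed[OF f]])

lemma sinv_set_Ident: "a \<in> Ob R \<Longrightarrow> sinv_set R (Ident R a) = {}"
  using Ident_closed[of a]
  by (auto simp: sinv_set_def Inv_Ident Act_Ident Hom_CodD Hom_DomD)

text \<open>Up to transport along \<open>f\<close>, the inversion set of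
  \<open>Inv R f \<cdot> h\<close> is the symmetric difference of those of \<open>f\<close> and
  \<open>h\<close>. Most comparisons below rest on this.\<close>

lemma sinv_set_Inv_Comp_iff:
  assumes f: "f \<in> Hom R a b" and h: "h \<in> Hom R a c" and x: "x \<in> Phi R b"
  shows "x \<in> sinv_set R (Inv R f \<cdot> h) \<longleftrightarrow> (Act R f x \<in> sinv_set R f) \<noteq> (Act R f x \<in> sinv_set R h)"
  using sinv_set_Comp_iff[OF Inv_closed[OF f] h x] sinv_set_Inv_iff[OF f x] Inv_Inv[OF f] by simp

text \<open>Both inversion sets consist of positive roots, so if \<open>f\<close> carries one onto
  the other, its inverse changes no sign on \<open>inv_set R y\<close>; this is the disjointness.
  Conversely, disjointness makes transport of the sign-closed sets respect positivity.\<close>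

lemma image_inv_set_eq_iff:
  assumes f: "f \<in> Hom R a b" and x: "x \<in> Star R b" and y: "y \<in> Star R a"
  shows "Act R f ` inv_set R x = inv_set R y \<longleftrightarrow>
    (\<forall>\<alpha> \<in> Phi R a. \<alpha> \<in> sinv_set R y \<longleftrightarrow> Act R (Inv R f) \<alpha> \<in> sinv_set R x) \<and>
    sinv_set R f \<inter> sinv_set R y = {}" (is "?L \<longleftrightarrow> ?R1 \<and> ?R2")
proof -
  note [simp] = Hom_CodD[OF f] Hom_DomD[OF f]
  have fS: "f \<in> Star R a"
    by (rule Hom_imp_Star[OF f])
  have ob: "a \<in> Ob R" "b \<in> Ob R"
    using Hom_Ob[OF f] by auto
  note pa = Phi_pos_subset[OF ob(1)] and pb = Phi_pos_subset[OF ob(2)]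
  show ?thesis
  proof (intro iffI conjI)
    assume L: ?L
    have mem: "\<alpha> \<in> inv_set R y \<longleftrightarrow> Act R (Inv R f) \<alpha> \<in> inv_set R x" if "\<alpha> \<in> Phi R a" for \<alpha>
    proof
      assume "\<alpha> \<in> inv_set R y"
      then obtain \<beta> where b: "\<beta> \<in> inv_set R x" "\<alpha> = Act R f \<beta>"
        using L by blast
      then have "\<beta> \<in> Phi R b"
        using inv_set_eq[OF x] pb by blast
      then show "Act R (Inv R f) \<alpha> \<in> inv_set R x"
        using b Act_Inv_Act[OF f] by simp
    next
      assume "Act R (Inv R f) \<alpha> \<in> inv_set R x"
      then show "\<alpha> \<in> inv_set R y"
        using L Act_Act_Inv[OF f that] by (metis imageI)
    qed
    have dis: "inv_set R f \<inter> inv_set R y = {}"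
    proof -
      have "\<alpha> \<notin> sinv_set R f" if "\<alpha> \<in> inv_set R y" for \<alpha>
      proof -
        have p: "\<alpha> \<in> Phi_pos R a"
          using that inv_set_eq[OF y] by blast
        with that mem[of \<alpha>] pa have "Act R (Inv R f) \<alpha> \<in> Phi_pos R b"
          using inv_set_eq[OF x] by blast
        then show ?thesis
          using p by (simp add: sinv_set_def)
      qed
      then show ?thesis
        using inv_set_eq[OF fS] by blast
    qed
    then show ?R2
      using inv_set_disjoint_iff[OF fS y] by blast
    show ?R1
    proof
      fix \<alpha> assume \<alpha>: "\<alpha> \<in> Phi R a"
      let ?i = "Act R (Inv R f)"
      have i: "?i \<alpha> \<in> Phi R b"
        by (rule Act_closed[OF Inv_closed[OF f] \<alpha>])
      have n: "?i (Neg R a \<alpha>) = Neg R b (?i \<alpha>)"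
        by (rule Act_Neg[OF Inv_closed[OF f] \<alpha>])
      \<comment> \<open>A root lies in the sign-closed set iff it or its negative lies in the
        positive part, so \<open>mem\<close> is applied to both.\<close>
      have m1: "\<alpha> \<in> sinv_set R y \<longleftrightarrow> \<alpha> \<in> inv_set R y \<or> Neg R a \<alpha> \<in> inv_set R y"
        using inv_set_eq[OF y] Neg_sinv_set_iff[OF y \<alpha>] Neg_pos_iff[OF ob(1) \<alpha>] by blast
      have m2: "?i \<alpha> \<in> sinv_set R x \<longleftrightarrow> ?i \<alpha> \<in> inv_set R x \<or> Neg R b (?i \<alpha>) \<in> inv_set R x"
        using inv_set_eq[OF x] Neg_sinv_set_iff[OF x i] Neg_pos_iff[OF ob(2) i] by blast
      show "\<alpha> \<in> sinv_set R y \<longleftrightarrow> ?i \<alpha> \<in> sinv_set R x"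
        using m1 m2 mem[OF \<alpha>] mem[OF Neg_closed[OF ob(1) \<alpha>]] n by simp
    qed
  next
    assume R: "?R1 \<and> ?R2"
    have pos: "\<alpha> \<in> Phi_pos R a \<longleftrightarrow> Act R (Inv R f) \<alpha> \<in> Phi_pos R b"
      if "\<alpha> \<in> sinv_set R y" for \<alpha>
    proof -
      have "\<alpha> \<in> Phi R a" "\<alpha> \<notin> sinv_set R f"
        using that R sinv_set_subset_Phi[OF y] by auto
      then show ?thesis
        by (simp add: sinv_set_def)
    qed
    have mem: "\<alpha> \<in> inv_set R y \<longleftrightarrow> Act R (Inv R f) \<alpha> \<in> inv_set R x" if "\<alpha> \<in> Phi R a" for \<alpha>
      using R that pos inv_set_eq[OF x] inv_set_eq[OF y] by blast
    show ?L
    proof (intro equalityI subsetI)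
      fix \<alpha> assume "\<alpha> \<in> Act R f ` inv_set R x"
      then obtain \<beta> where b: "\<beta> \<in> inv_set R x" "\<alpha> = Act R f \<beta>"
        by blast
      then have "\<beta> \<in> Phi R b"
        using inv_set_eq[OF x] pb by blast
      then show "\<alpha> \<in> inv_set R y"
        using b mem Act_Inv_Act[OF f] Act_closed[OF f] by simp
    next
      fix \<alpha> assume m: "\<alpha> \<in> inv_set R y"
      then have "\<alpha> \<in> Phi R a"
        using inv_set_eq[OF y] pa by blast
      then show "\<alpha> \<in> Act R f ` inv_set R x"
        using m mem Act_Act_Inv[OF f] by (metis imageI)
    qed
  qed
qed

lemma image_inv_set_Inv:
  assumes f: "f \<in> Hom R a b" and x: "x \<in> Star R b" and eq: "Act R f ` inv_set R x = S"
  shows "Act R (Inv R f) ` S = inv_set R x"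
proof -
  have "inv_set R x \<subseteq> Phi R b"
    using inv_set_eq[OF x] Phi_pos_subset Hom_Ob[OF f] by blast
  then show ?thesis
    using eq Act_Inv_Act[OF f] by (force simp: image_image subset_iff)
qed

lemma image_inv_set_Comp:
  assumes f: "f \<in> Hom R a b" and g: "g \<in> Hom R b c" and x: "x \<in> Star R c"
  shows "Act R (f \<cdot> g) ` inv_set R x = Act R f ` Act R g ` inv_set R x"
proof -
  have "inv_set R x \<subseteq> Phi R c"
    using inv_set_eq[OF x] Phi_pos_subset Hom_Ob[OF g] by blast
  then show ?thesis
    using Act_Comp[OF f g] by (force simp: image_image subset_iff)
qed

end

section \<open>Weak orders\<close>

text \<open>
  \<open>g\<close> is the join of \<open>A\<close> in the weak order at \<open>a\<close>; taking \<open>k = g\<close> shows that it is an upper bound.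
\<close>

definition is_join :: "('o, 'm, 'r, 'z) sgs_scheme \<Rightarrow> 'o \<Rightarrow> 'm set \<Rightarrow> 'm \<Rightarrow> bool" where
  "is_join R a A g \<longleftrightarrow> g \<in> Star R a \<and>
     (\<forall>k \<in> Star R a. sinv_set R g \<subseteq> sinv_set R k \<longleftrightarrow> (\<forall>h \<in> A. sinv_set R h \<subseteq> sinv_set R k))"

definition is_top :: "('o, 'm, 'r, 'z) sgs_scheme \<Rightarrow> 'o \<Rightarrow> 'm \<Rightarrow> bool" where
  "is_top R a w \<longleftrightarrow> w \<in> Star R a \<and> (\<forall>h \<in> Star R a. sinv_set R h \<subseteq> sinv_set R w)"

context faithful_sgs
begin

lemma sinv_set_empty_imp_Ident:
  assumes g: "g \<in> Star R a" and e: "sinv_set R g = {}"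
  shows "g = Ident R a"
proof -
  have "g \<in> Mor R"
    using g by (auto simp: Star_def)
  then obtain b where "b \<in> Ob R" "g = Ident R b"
    using faithful e inv_set_eq[OF g] by blast
  then show ?thesis
    using g Ident_closed by (auto simp: Star_def Hom_def)
qed

text \<open>Equal sets have empty symmetric difference, so \<open>Inv R g \<cdot> h\<close> inverts
  no root and faithfulness makes it an identity.\<close>

lemma sinv_set_inj:
  assumes g: "g \<in> Star R a" and h: "h \<in> Star R a" and eq: "sinv_set R g = sinv_set R h"
  shows "g = h"
proof -
  have gH: "g \<in> Hom R a (Dom R g)" and hH: "h \<in> Hom R a (Dom R h)"
    using g h by (auto simp: Star_iff_Hom)
  have k: "Inv R g \<cdot> h \<in> Hom R (Dom R g) (Dom R h)"
    by (rule Comp_closed[OF Inv_closed[OF gH] hH])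
  have "sinv_set R (Inv R g \<cdot> h) = {}"
    using sinv_set_Inv_Comp_iff[OF gH hH] eq sinv_set_subset_Phi[OF Hom_imp_Star[OF k]] by blast
  then have "Inv R g \<cdot> h = Ident R (Dom R g)"
    using sinv_set_empty_imp_Ident Hom_imp_Star[OF k] by blast
  then show ?thesis
    using Comp_Inv_cancel[OF gH hH] Ident_right[OF gH] by simp
qed

lemma inv_set_inj:
  assumes "g \<in> Star R a" "h \<in> Star R a" "inv_set R g = inv_set R h"
  shows "g = h"
  using assms inv_set_subset_iff sinv_set_inj by (metis order_antisym order_refl)

lemma weak_order_partial_order: "partial_order (weak_order R a)"
  by unfold_locales
    (use inv_set_inj in \<open>auto simp: weak_order_def\<close>)

lemma least_Upper_weak_order_iff:
  assumes A: "A \<subseteq> Star R a"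
  shows "least (weak_order R a) g (Upper (weak_order R a) A) \<longleftrightarrow> is_join R a A g"
proof -
  note sub = inv_set_subset_iff[where a = a]
  have up: "Upper (weak_order R a) A = {k \<in> Star R a. \<forall>h \<in> A. sinv_set R h \<subseteq> sinv_set R k}"
    (is "?U = ?K")
  proof -
    have "?U = {k \<in> Star R a. \<forall>h \<in> A. inv_set R h \<subseteq> inv_set R k}"
      using A by (auto simp: Upper_def weak_order_def)
    also have "\<dots> = ?K"
      using A by (intro Collect_cong conj_cong ball_cong refl sub) auto
    finally show ?thesis .
  qed
  have "least (weak_order R a) g ?K \<longleftrightarrow> g \<in> ?K \<and> (\<forall>k \<in> ?K. inv_set R g \<subseteq> inv_set R k)"
    by (auto simp: least_def weak_order_def)
  also have "\<dots> \<longleftrightarrow> g \<in> ?K \<and> (\<forall>k \<in> ?K. sinv_set R g \<subseteq> sinv_set R k)"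
    by (intro conj_cong ball_cong refl sub) auto
  also have "\<dots> \<longleftrightarrow> is_join R a A g"
    unfolding is_join_def by blast
  finally show ?thesis
    unfolding up .
qed

text \<open>Joins suffice, since the infimum of a set is the join of its lower bounds.\<close>

lemma weak_order_completeI:
  assumes joins: "\<And>A. A \<subseteq> Star R a \<Longrightarrow> \<exists>g. is_join R a A g"
  shows "complete_lattice (weak_order R a)"
proof -
  interpret partial_order "weak_order R a"
    by (rule weak_order_partial_order)
  have car: "carrier (weak_order R a) = Star R a"
    by (simp add: weak_order_def)
  have sup: "\<exists>s. least (weak_order R a) s (Upper (weak_order R a) A)"
    if "A \<subseteq> carrier (weak_order R a)" for A
    using joins that least_Upper_weak_order_iff car by metis
  show ?thesis
  proof (rule complete_latticeI)
    fix A assume A: "A \<subseteq> carrier (weak_order R a)"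
    let ?B = "Lower (weak_order R a) A"
    obtain b where b: "least (weak_order R a) b (Upper (weak_order R a) ?B)"
      using sup[of ?B] by auto
    have "greatest (weak_order R a) b ?B"
    proof (rule greatest_LowerI)
      show "b \<sqsubseteq>\<^bsub>weak_order R a\<^esub> x" if "x \<in> A" for x
        using least_le[OF b] that A by (auto simp: Upper_def Lower_def)
      show "y \<sqsubseteq>\<^bsub>weak_order R a\<^esub> b" if "y \<in> ?B" for y
        using least_mem[OF b] that by (auto simp: Upper_def Lower_def)
    qed (use A b in auto)
    then show "\<exists>i. greatest (weak_order R a) i ?B" ..
  qed (rule sup)
qed

text \<open>The least element at \<open>a\<close> is the identity, whose inversion set is empty;
  atoms thus become the minimal nonempty inversion sets.\<close>

lemma atomic_iff:
  assumes s: "s \<in> Star R a"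
  shows "atomic R s \<longleftrightarrow> sinv_set R s \<noteq> {} \<and>
    (\<forall>k \<in> Star R a. sinv_set R k \<subseteq> sinv_set R s \<longrightarrow> sinv_set R k = {} \<or> sinv_set R k = sinv_set R s)"
proof -
  have M: "s \<in> Mor R" "Cod R s = a"
    using s by (auto simp: Star_def)
  have ob: "a \<in> Ob R"
    using M Cod_closed by blast
  have IS: "Ident R a \<in> Star R a"
    by (rule Hom_imp_Star[OF Ident_closed[OF ob]])
  have sub: "inv_set R g \<subseteq> inv_set R h \<longleftrightarrow> sinv_set R g \<subseteq> sinv_set R h"
    if "g \<in> Star R a" "h \<in> Star R a" for g h
    by (rule inv_set_subset_iff[OF that])
  have eq: "g = h \<longleftrightarrow> sinv_set R g = sinv_set R h" if "g \<in> Star R a" "h \<in> Star R a" for g h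
    using sinv_set_inj[OF that] by blast
  have least: "least (weak_order R a) b (carrier (weak_order R a)) \<longleftrightarrow> b = Ident R a" for b
  proof
    assume "least (weak_order R a) b (carrier (weak_order R a))"
    then have "b \<in> Star R a" "inv_set R b \<subseteq> inv_set R (Ident R a)"
      using IS by (auto simp: least_def weak_order_def)
    then show "b = Ident R a"
      using sub[OF _ IS] sinv_set_Ident[OF ob] sinv_set_empty_imp_Ident by blast
  next
    assume "b = Ident R a"
    then show "least (weak_order R a) b (carrier (weak_order R a))"
      using IS inv_set_eq[OF IS] sinv_set_Ident[OF ob] by (auto simp: least_def weak_order_def)
  qed
  have "atomic R s \<longleftrightarrow> s \<noteq> Ident R a \<and>
      (\<forall>y \<in> Star R a. inv_set R y \<subseteq> inv_set R s \<longrightarrow> y = Ident R a \<or> y = s)"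
    unfolding atomic_def atom_def M least using M(1) s by (simp add: weak_order_def)
  then show ?thesis
    using sub[OF _ s] eq[OF _ s] eq[OF _ IS] eq[OF s IS] sinv_set_Ident[OF ob] by simp
qed

end

section \<open>Complements and joins in complete weak orders\<close>

context complete_sgs
begin

lemma join_exists:
  assumes "a \<in> Ob R" "A \<subseteq> Star R a"
  obtains g where "is_join R a A g"
proof -
  interpret complete_lattice "weak_order R a"
    by (rule weak_order_complete[OF assms(1)])
  have "A \<subseteq> carrier (weak_order R a)"
    using assms(2) by (simp add: weak_order_def)
  from sup_exists[OF this] show ?thesis
    using that least_Upper_weak_order_iff[OF assms(2)] by blast
qed

lemma top_exists:
  assumes "a \<in> Ob R"
  obtains w where "is_top R a w"
proof -
  obtain w where "is_join R a (Star R a) w"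
    using join_exists[OF assms order_refl] .
  then have "is_top R a w"
    unfolding is_join_def is_top_def by blast
  then show ?thesis
    by (rule that)
qed

lemma complement_exists:
  assumes w: "is_top R a w" and g: "g \<in> Star R a"
  obtains g' where "g' \<in> Star R a" "sinv_set R g' = sinv_set R w - sinv_set R g"
proof -
  define c where "c = Dom R g"
  have gH: "g \<in> Hom R a c"
    using g by (simp add: c_def Star_iff_Hom)
  obtain v where v: "is_top R c v"
    using top_exists Hom_Ob[OF gH] by blast
  have wS: "w \<in> Star R a" and wtop: "\<And>h. h \<in> Star R a \<Longrightarrow> sinv_set R h \<subseteq> sinv_set R w"
    using w by (auto simp: is_top_def)
  have vH: "v \<in> Hom R c (Dom R v)" and vtop: "\<And>h. h \<in> Star R c \<Longrightarrow> sinv_set R h \<subseteq> sinv_set R v"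
    using v by (auto simp: is_top_def Star_iff_Hom)
  have wH: "w \<in> Hom R a (Dom R w)"
    using wS by (simp add: Star_iff_Hom)
  \<comment> \<open>With \<open>v\<close> greatest at the domain of \<open>g\<close>, passing from
    \<open>g\<close> to \<open>g \<cdot> v\<close> should remove all roots of \<open>g\<close> and
    gain all others that can be inverted.\<close>
  let ?g' = "g \<cdot> v"
  have g'S: "?g' \<in> Star R a"
    by (rule Hom_imp_Star[OF Comp_closed[OF gH vH]])
  have mem: "\<alpha> \<in> sinv_set R ?g' \<longleftrightarrow> \<alpha> \<in> sinv_set R w - sinv_set R g" if \<alpha>: "\<alpha> \<in> Phi R a" for \<alpha>
  proof -
    let ?\<beta> = "Act R (Inv R g) \<alpha>"
    have \<beta>: "?\<beta> \<in> Phi R c" and inverse: "Act R g ?\<beta> = \<alpha>"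
      using Act_closed[OF Inv_closed[OF gH] \<alpha>] Act_Act_Inv[OF gH \<alpha>] by auto
    have 1: "\<alpha> \<in> sinv_set R ?g' \<longleftrightarrow> (\<alpha> \<in> sinv_set R g) \<noteq> (?\<beta> \<in> sinv_set R v)"
      by (rule sinv_set_Comp_iff[OF gH vH \<alpha>])
    have 2: "\<alpha> \<in> sinv_set R g \<Longrightarrow> ?\<beta> \<in> sinv_set R v"
      using vtop[OF Hom_imp_Star[OF Inv_closed[OF gH]]] sinv_set_Inv_iff[OF gH \<beta>] inverse by auto
    \<comment> \<open>Maximality of \<open>v\<close> is used twice: against \<open>Inv R g\<close>
      in fact 2, and here against \<open>Inv R g \<cdot> w\<close>, whose inversion set is the
      transported symmetric difference of those of \<open>g\<close> and \<open>w\<close>.\<close>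
    have 3: "(\<alpha> \<in> sinv_set R g) \<noteq> (\<alpha> \<in> sinv_set R w) \<Longrightarrow> ?\<beta> \<in> sinv_set R v"
      using vtop[OF Hom_imp_Star[OF Comp_closed[OF Inv_closed[OF gH] wH]]]
        sinv_set_Inv_Comp_iff[OF gH wH \<beta>] inverse by auto
    show ?thesis
      using 1 2 3 wtop[OF g'S] wtop[OF g] by blast
  qed
  have "sinv_set R ?g' = sinv_set R w - sinv_set R g"
    using mem sinv_set_subset_Phi[OF g'S] sinv_set_subset_Phi[OF wS] by blast
  with g'S show ?thesis
    using that by blast
qed

text \<open>Disjointness from \<open>g\<close> amounts to lying below the complement of
  \<open>g\<close>, and a common upper bound also bounds the join.\<close>

lemma join_disjoint:
  assumes F: "is_join R a A F" and A: "A \<subseteq> Star R a" and g: "g \<in> Star R a"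
    and dis: "\<And>h. h \<in> A \<Longrightarrow> sinv_set R h \<inter> sinv_set R g = {}"
  shows "sinv_set R F \<inter> sinv_set R g = {}"
proof -
  have "a \<in> Ob R"
    using g Hom_Ob by (auto simp: Star_iff_Hom)
  then obtain w where w: "is_top R a w"
    using top_exists by blast
  obtain g' where g': "g' \<in> Star R a" "sinv_set R g' = sinv_set R w - sinv_set R g"
    using complement_exists[OF w g] by blast
  have "sinv_set R h \<subseteq> sinv_set R g'" if "h \<in> A" for h
  proof -
    have "sinv_set R h \<subseteq> sinv_set R w"
      using w A that by (auto simp: is_top_def)
    then show ?thesis
      using dis[OF that] g'(2) by blast
  qed
  then have "sinv_set R F \<subseteq> sinv_set R g'"
    using F g'(1) by (simp add: is_join_def)
  then show ?thesis
    using g'(2) by blast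
qed

end


lemma (in preprincipal_sgs) atomic_below:
  assumes s: "s \<in> Star R a" and ne: "sinv_set R s \<noteq> {}"
  obtains r where "r \<in> Star R a" "atomic R r" "sinv_set R r \<subseteq> sinv_set R s"
proof -
  have ob: "a \<in> Ob R"
    using s Cod_closed by (auto simp: Star_def)
  let ?I = "{k \<in> Star R a. sinv_set R k \<subseteq> sinv_set R s \<and> sinv_set R k \<noteq> {}}"
  have "{h \<in> Star R a. h \<sqsubseteq>\<^bsub>weak_order R a\<^esub> s} = {h \<in> Star R a. sinv_set R h \<subseteq> sinv_set R s}"
    using inv_set_subset_iff[OF _ s] by (auto simp: weak_order_def)
  then have "finite {h \<in> Star R a. sinv_set R h \<subseteq> sinv_set R s}"
    using interval_finite ob s unfolding interval_finite_def by fastforce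
  then have "finite (sinv_set R ` ?I)"
    by (rule finite_imageI[OF finite_subset[rotated]]) blast
  moreover have "sinv_set R ` ?I \<noteq> {}"
    using s ne by blast
  \<comment> \<open>Interval finiteness yields a minimal nonempty inversion set below that of
    \<open>s\<close>; it belongs to an atom.\<close>
  ultimately have "\<exists>M \<in> sinv_set R ` ?I. \<forall>N \<in> sinv_set R ` ?I. N \<subseteq> M \<longrightarrow> M = N"
    by (rule finite_has_minimal)
  then obtain M where M: "M \<in> sinv_set R ` ?I"
      and min: "\<forall>N \<in> sinv_set R ` ?I. N \<subseteq> M \<longrightarrow> M = N" ..
  then obtain r where r: "r \<in> ?I" "M = sinv_set R r"
    by blast
  have "atomic R r"
  proof (subst atomic_iff[of r a], use r in blast, intro conjI ballI impI)
    fix k assume k: "k \<in> Star R a" "sinv_set R k \<subseteq> sinv_set R r"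
    show "sinv_set R k = {} \<or> sinv_set R k = sinv_set R r"
    proof (cases "sinv_set R k = {}")
      case False
      then have "sinv_set R k \<in> sinv_set R ` ?I"
        using k r by blast
      then show ?thesis
        using min k(2) r(2) by blast
    qed simp
  qed (use r in auto)
  with r show ?thesis
    using that by blast
qed

section \<open>Independence\<close>

text \<open>
  Equivalently, the join \<open>fx = yz\<close> of \<open>f\<close> and \<open>y\<close> is the diagonal of a square \<open>(f, x, y, z)\<close>.
\<close>

definition independent :: "('o, 'm, 'r, 'z) sgs_scheme \<Rightarrow> 'o \<Rightarrow> 'm \<Rightarrow> 'm \<Rightarrow> bool" where
  "independent R a f y \<longleftrightarrow> sinv_set R f \<inter> sinv_set R y = {} \<and>
     (\<exists>h \<in> Star R a. sinv_set R h = sinv_set R f \<union> sinv_set R y)"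

text \<open>The two witnesses correspond by \<open>x = Inv R f \<cdot> h\<close> and
  \<open>h = f \<cdot> x\<close>: as the inversion set of \<open>h\<close> contains that of
  \<open>f\<close>, their symmetric difference is what \<open>y\<close> contributes.\<close>

lemma (in signed_groupoid_set) independent_iff:
  assumes f: "f \<in> Hom R a b" and y: "y \<in> Star R a"
  shows "independent R a f y \<longleftrightarrow> (\<exists>x \<in> Star R b. Act R f ` inv_set R x = inv_set R y)"
proof
  assume "independent R a f y"
  then obtain h where h: "h \<in> Star R a" "sinv_set R h = sinv_set R f \<union> sinv_set R y"
      and dis: "sinv_set R f \<inter> sinv_set R y = {}"
    by (auto simp: independent_def)
  have hH: "h \<in> Hom R a (Dom R h)"
    using h(1) by (simp add: Star_iff_Hom)
  have xS: "Inv R f \<cdot> h \<in> Star R b"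
    by (rule Hom_imp_Star[OF Comp_closed[OF Inv_closed[OF f] hH]])
  have "\<alpha> \<in> sinv_set R y \<longleftrightarrow> Act R (Inv R f) \<alpha> \<in> sinv_set R (Inv R f \<cdot> h)"
    if \<alpha>: "\<alpha> \<in> Phi R a" for \<alpha>
    using sinv_set_Inv_Comp_iff[OF f hH Act_closed[OF Inv_closed[OF f] \<alpha>]]
      Act_Act_Inv[OF f \<alpha>] h(2) dis by auto
  then show "\<exists>x \<in> Star R b. Act R f ` inv_set R x = inv_set R y"
    using image_inv_set_eq_iff[OF f xS y] dis xS by blast
next
  assume "\<exists>x \<in> Star R b. Act R f ` inv_set R x = inv_set R y"
  then obtain x where x: "x \<in> Star R b" "Act R f ` inv_set R x = inv_set R y" ..
  note iff = iffD1[OF image_inv_set_eq_iff[OF f x(1) y] x(2)]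
  have xH: "x \<in> Hom R b (Dom R x)"
    using x(1) by (simp add: Star_iff_Hom)
  have hS: "f \<cdot> x \<in> Star R a"
    by (rule Hom_imp_Star[OF Comp_closed[OF f xH]])
  have "\<alpha> \<in> sinv_set R (f \<cdot> x) \<longleftrightarrow> \<alpha> \<in> sinv_set R f \<union> sinv_set R y" if "\<alpha> \<in> Phi R a" for \<alpha>
    using sinv_set_Comp_iff[OF f xH that] iff that by blast
  then have "sinv_set R (f \<cdot> x) = sinv_set R f \<union> sinv_set R y"
    using sinv_set_subset_Phi[OF hS] sinv_set_subset_Phi[OF Hom_imp_Star[OF f]]
      sinv_set_subset_Phi[OF y] by blast
  then show "independent R a f y"
    using iff hS by (auto simp: independent_def)
qed

text \<open>
  The squares \<open>(f, x\<^sub>f, y, z\<^sub>f)\<close> for \<open>f \<in> A\<close> are joined by joining the edges \<open>z\<^sub>f\<close> opposite to \<open>f\<close>.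
\<close>

lemma (in complete_sgs) independent_join:
  assumes F: "is_join R a A F" and A: "A \<subseteq> Star R a" and y: "y \<in> Star R a"
    and ind: "\<And>f. f \<in> A \<Longrightarrow> independent R a f y"
  shows "independent R a F y"
proof -
  define c where "c = Dom R y"
  have yH: "y \<in> Hom R a c"
    using y by (simp add: c_def Star_iff_Hom)
  note yI = Inv_closed[OF yH]
  have FS: "F \<in> Star R a" and Fle: "\<And>k. k \<in> Star R a \<Longrightarrow>
      sinv_set R F \<subseteq> sinv_set R k \<longleftrightarrow> (\<forall>h \<in> A. sinv_set R h \<subseteq> sinv_set R k)"
    using F by (auto simp: is_join_def)
  have FH: "F \<in> Hom R a (Dom R F)"
    using FS by (simp add: Star_iff_Hom)
  have dis: "sinv_set R F \<inter> sinv_set R y = {}"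
    by (rule join_disjoint[OF F A y]) (use ind in \<open>auto simp: independent_def\<close>)
  \<comment> \<open>The opposite edges: the inversion set of such a \<open>z\<close> is that of some
    \<open>f\<close> in \<open>A\<close> carried back along \<open>y\<close>. The witness for
    \<open>f\<close> is \<open>Inv R y \<cdot> h\<close>, with \<open>h\<close> the diagonal of its
    square.\<close>
  define Zs where "Zs = {z \<in> Star R c. \<exists>f \<in> A. \<forall>\<beta> \<in> Phi R c.
      \<beta> \<in> sinv_set R z \<longleftrightarrow> Act R y \<beta> \<in> sinv_set R f}"
  have ex: "\<exists>z \<in> Zs. \<forall>\<beta> \<in> Phi R c. \<beta> \<in> sinv_set R z \<longleftrightarrow> Act R y \<beta> \<in> sinv_set R f" if f: "f \<in> A" for f
  proof -
    obtain h where h: "h \<in> Star R a" "sinv_set R h = sinv_set R f \<union> sinv_set R y"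
        and fy: "sinv_set R f \<inter> sinv_set R y = {}"
      using ind[OF f] by (auto simp: independent_def)
    have hH: "h \<in> Hom R a (Dom R h)"
      using h(1) by (simp add: Star_iff_Hom)
    have "Inv R y \<cdot> h \<in> Star R c"
      by (rule Hom_imp_Star[OF Comp_closed[OF yI hH]])
    moreover have "\<forall>\<beta> \<in> Phi R c. \<beta> \<in> sinv_set R (Inv R y \<cdot> h) \<longleftrightarrow> Act R y \<beta> \<in> sinv_set R f"
      using sinv_set_Inv_Comp_iff[OF yH hH] h(2) fy by blast
    ultimately show ?thesis
      using f unfolding Zs_def by blast
  qed
  have ZsS: "Zs \<subseteq> Star R c"
    by (auto simp: Zs_def)
  obtain Z where Z: "is_join R c Zs Z"
    using join_exists[OF _ ZsS] Hom_Ob[OF yH] by blast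
  have ZS: "Z \<in> Star R c" and Zle: "\<And>k. k \<in> Star R c \<Longrightarrow>
      sinv_set R Z \<subseteq> sinv_set R k \<longleftrightarrow> (\<forall>h \<in> Zs. sinv_set R h \<subseteq> sinv_set R k)"
    using Z by (auto simp: is_join_def)
  have ZH: "Z \<in> Hom R c (Dom R Z)"
    using ZS by (simp add: Star_iff_Hom)
  \<comment> \<open>Carried back along \<open>y\<close>, the inversion set of \<open>y\<close>
    becomes that of \<open>Inv R y\<close>, so each \<open>z\<close> avoids it because
    \<open>f\<close> avoids \<open>y\<close>. The join \<open>Z\<close> inherits this, and the
    exclusive disjunction for \<open>y \<cdot> Z\<close> becomes a union.\<close>
  have Zdis: "sinv_set R Z \<inter> sinv_set R (Inv R y) = {}"
  proof (rule join_disjoint[OF Z ZsS Hom_imp_Star[OF yI]])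
    fix z assume z: "z \<in> Zs"
    then obtain f where f: "f \<in> A" "\<forall>\<beta> \<in> Phi R c. \<beta> \<in> sinv_set R z \<longleftrightarrow> Act R y \<beta> \<in> sinv_set R f"
      unfolding Zs_def by blast
    moreover have "sinv_set R f \<inter> sinv_set R y = {}"
      using ind[OF f(1)] by (simp add: independent_def)
    moreover have "sinv_set R z \<subseteq> Phi R c"
      using z ZsS sinv_set_subset_Phi by blast
    ultimately show "sinv_set R z \<inter> sinv_set R (Inv R y) = {}"
      using sinv_set_Inv_iff[OF yH] by blast
  qed
  let ?h = "y \<cdot> Z"
  have hS: "?h \<in> Star R a"
    by (rule Hom_imp_Star[OF Comp_closed[OF yH ZH]])
  have hmem: "\<alpha> \<in> sinv_set R ?h \<longleftrightarrow> \<alpha> \<in> sinv_set R y \<or> Act R (Inv R y) \<alpha> \<in> sinv_set R Z"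
    if \<alpha>: "\<alpha> \<in> Phi R a" for \<alpha>
    using sinv_set_Comp_iff[OF yH ZH \<alpha>] Zdis Act_Act_Inv[OF yH \<alpha>]
      sinv_set_Inv_iff[OF yH Act_closed[OF yI \<alpha>]] by auto
  have "sinv_set R f \<subseteq> sinv_set R ?h" if f: "f \<in> A" for f
  proof
    fix \<alpha> assume \<alpha>: "\<alpha> \<in> sinv_set R f"
    then have \<alpha>P: "\<alpha> \<in> Phi R a"
      using f A sinv_set_subset_Phi by blast
    obtain z where z: "z \<in> Zs" "\<forall>\<beta> \<in> Phi R c. \<beta> \<in> sinv_set R z \<longleftrightarrow> Act R y \<beta> \<in> sinv_set R f"
      using ex[OF f] by blast
    then have "Act R (Inv R y) \<alpha> \<in> sinv_set R z"
      using \<alpha> Act_closed[OF yI \<alpha>P] Act_Act_Inv[OF yH \<alpha>P] by simp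
    then show "\<alpha> \<in> sinv_set R ?h"
      using hmem[OF \<alpha>P] Zle[OF ZS] z(1) by blast
  qed
  then have sub: "sinv_set R F \<subseteq> sinv_set R ?h"
    using Fle[OF hS] by blast
  \<comment> \<open>For the reverse inclusion, \<open>Inv R y \<cdot> F\<close> is an upper bound of
    \<open>Zs\<close> and so lies above \<open>Z\<close>; multiplying by \<open>y\<close> then gives
    no roots beyond those of \<open>F\<close> and \<open>y\<close>.\<close>
  have yFS: "Inv R y \<cdot> F \<in> Star R c"
    by (rule Hom_imp_Star[OF Comp_closed[OF yI FH]])
  have yFmem: "\<beta> \<in> sinv_set R (Inv R y \<cdot> F) \<longleftrightarrow> Act R y \<beta> \<in> sinv_set R y \<or> Act R y \<beta> \<in> sinv_set R F"
    if "\<beta> \<in> Phi R c" for \<beta>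
    using sinv_set_Inv_Comp_iff[OF yH FH that] dis by blast
  have "sinv_set R z \<subseteq> sinv_set R (Inv R y \<cdot> F)" if z: "z \<in> Zs" for z
  proof
    fix \<beta> assume \<beta>: "\<beta> \<in> sinv_set R z"
    then have \<beta>P: "\<beta> \<in> Phi R c"
      using z ZsS sinv_set_subset_Phi by blast
    then obtain f where "f \<in> A" "Act R y \<beta> \<in> sinv_set R f"
      using z \<beta> unfolding Zs_def by blast
    then show "\<beta> \<in> sinv_set R (Inv R y \<cdot> F)"
      using yFmem[OF \<beta>P] Fle[OF FS] by blast
  qed
  then have sub': "sinv_set R Z \<subseteq> sinv_set R (Inv R y \<cdot> F)"
    using Zle[OF yFS] by blast
  have "\<alpha> \<in> sinv_set R ?h \<longleftrightarrow> \<alpha> \<in> sinv_set R F \<union> sinv_set R y" if \<alpha>: "\<alpha> \<in> Phi R a" for \<alpha>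
    using hmem[OF \<alpha>] sub sub' yFmem[OF Act_closed[OF yI \<alpha>]] Act_Act_Inv[OF yH \<alpha>] by auto
  then have "sinv_set R ?h = sinv_set R F \<union> sinv_set R y"
    using sinv_set_subset_Phi[OF hS] sinv_set_subset_Phi[OF FS] sinv_set_subset_Phi[OF y] by blast
  then show ?thesis
    using dis hS by (auto simp: independent_def)
qed

section \<open>The box construction\<close>

lemma box_simps [simp]:
  "Ob (box_sgs R) = box_Ob R"
  "Dom (box_sgs R) (B, f, A) = A"
  "Cod (box_sgs R) (B, f, A) = B"
  "Comp (box_sgs R) (C, f, B) (B', g, A) = (C, Comp R f g, A)"
  "Ident (box_sgs R) A = (A, Ident R (fst A), A)"
  "Inv (box_sgs R) (B, f, A) = (A, Inv R f, B)"
  "Phi (box_sgs R) A = Phi R (fst A)"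
  "Phi_pos (box_sgs R) A = Phi_pos R (fst A)"
  "Neg (box_sgs R) A = Neg R (fst A)"
  "Act (box_sgs R) (B, f, A) = Act R f"
  by (simp_all add: box_sgs_def split: prod.split)

lemma inv_set_box [simp]: "f \<in> Hom R (fst B) (fst A) \<Longrightarrow> inv_set (box_sgs R) (B, f, A) = inv_set R f"
  by (simp add: inv_set_def Phi_neg_def Hom_CodD Hom_DomD)

lemma sinv_set_box [simp]: "f \<in> Hom R (fst B) (fst A) \<Longrightarrow> sinv_set (box_sgs R) (B, f, A) = sinv_set R f"
  by (simp add: sinv_set_def Hom_CodD Hom_DomD)

section \<open>The box as a faithful signed groupoid set\<close>

context faithful_sgs
begin

text \<open>Inversion sets determine morphisms, so the bijection is forced and injective
  automatically. Only the equality of two families of sets remains, which is easy to compose and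
  invert.\<close>

lemma box_hom_iff:
  assumes A: "A \<in> box_Ob R" and B: "B \<in> box_Ob R"
  shows "f \<in> box_hom R B A \<longleftrightarrow> f \<in> Hom R (fst B) (fst A) \<and>
    (\<lambda>x. Act R f ` inv_set R x) ` snd A = inv_set R ` snd B"
proof (cases "f \<in> Hom R (fst B) (fst A)")
  case f: True
  have AS: "x \<in> Star R (fst A)" if "x \<in> snd A" for x
    using A that by (auto simp: box_Ob_def)
  have BS: "y \<in> Star R (fst B)" if "y \<in> snd B" for y
    using B that by (auto simp: box_Ob_def)
  have sq: "square R f x y (Inv R y \<cdot> f \<cdot> x) \<longleftrightarrow> Act R f ` inv_set R x = inv_set R y"
    if x: "x \<in> snd A" and y: "y \<in> snd B" for x y
  proof -
    have xH: "x \<in> Hom R (fst A) (Dom R x)" and yH: "y \<in> Hom R (fst B) (Dom R y)"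
      using AS[OF x] BS[OF y] by (simp_all add: Star_iff_Hom)
    note yf = Comp_closed[OF Inv_closed[OF yH] f]
    \<comment> \<open>The fourth edge is chosen to make the square commute, so only the condition on
      inversion sets is left.\<close>
    have "f \<cdot> x = y \<cdot> (Inv R y \<cdot> f \<cdot> x)"
      using Comp_assoc[OF yH yf xH] Comp_Inv_cancel[OF yH f] by simp
    then show ?thesis
      using f xH yH Comp_closed[OF yf xH] unfolding square_def by blast
  qed
  have "(\<exists>\<sigma>. bij_betw \<sigma> (snd A) (snd B) \<and>
          (\<forall>x \<in> snd A. square R f x (\<sigma> x) (Inv R (\<sigma> x) \<cdot> f \<cdot> x))) \<longleftrightarrow>
        (\<lambda>x. Act R f ` inv_set R x) ` snd A = inv_set R ` snd B"
  proof
    assume "\<exists>\<sigma>. bij_betw \<sigma> (snd A) (snd B) \<and>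
          (\<forall>x \<in> snd A. square R f x (\<sigma> x) (Inv R (\<sigma> x) \<cdot> f \<cdot> x))"
    then obtain \<sigma> where \<sigma>: "\<sigma> ` snd A = snd B"
        and "\<forall>x \<in> snd A. square R f x (\<sigma> x) (Inv R (\<sigma> x) \<cdot> f \<cdot> x)"
      by (auto simp: bij_betw_def)
    then have "\<forall>x \<in> snd A. Act R f ` inv_set R x = inv_set R (\<sigma> x)"
      using sq by blast
    then have "(\<lambda>x. Act R f ` inv_set R x) ` snd A = inv_set R ` \<sigma> ` snd A"
      by (simp add: image_image)
    then show "(\<lambda>x. Act R f ` inv_set R x) ` snd A = inv_set R ` snd B"
      using \<sigma> by simp
  next
    assume eq: "(\<lambda>x. Act R f ` inv_set R x) ` snd A = inv_set R ` snd B"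
    then have "\<forall>x \<in> snd A. \<exists>y \<in> snd B. Act R f ` inv_set R x = inv_set R y"
      by (metis (no_types, lifting) imageE image_eqI)
    then obtain \<sigma> where \<sigma>: "\<And>x. x \<in> snd A \<Longrightarrow> \<sigma> x \<in> snd B \<and> Act R f ` inv_set R x = inv_set R (\<sigma> x)"
      by metis
    have "inj_on \<sigma> (snd A)"
    proof (rule inj_onI)
      fix x x' assume x: "x \<in> snd A" "x' \<in> snd A" "\<sigma> x = \<sigma> x'"
      then have "Act R f ` inv_set R x = Act R f ` inv_set R x'"
        using \<sigma> by simp
      then have "inv_set R x = inv_set R x'"
        using image_inv_set_Inv[OF f AS refl] x by metis
      then show "x = x'"
        using inv_set_inj AS x by blast
    qed
    moreover have "\<sigma> ` snd A = snd B"
    proof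
      show "snd B \<subseteq> \<sigma> ` snd A"
      proof
        fix y assume y: "y \<in> snd B"
        then obtain x where x: "x \<in> snd A" "Act R f ` inv_set R x = inv_set R y"
          using eq by (metis (no_types, lifting) imageE image_eqI)
        then have "\<sigma> x = y"
          using \<sigma>[OF x(1)] inv_set_inj[OF BS BS] y by auto
        with x(1) show "y \<in> \<sigma> ` snd A"
          by blast
      qed
    qed (use \<sigma> in blast)
    ultimately have "bij_betw \<sigma> (snd A) (snd B)"
      by (simp add: bij_betw_def)
    moreover have "\<forall>x \<in> snd A. square R f x (\<sigma> x) (Inv R (\<sigma> x) \<cdot> f \<cdot> x)"
      using \<sigma> sq by simp
    ultimately show "\<exists>\<sigma>. bij_betw \<sigma> (snd A) (snd B) \<and>
          (\<forall>x \<in> snd A. square R f x (\<sigma> x) (Inv R (\<sigma> x) \<cdot> f \<cdot> x))"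
      by blast
  qed
  then show ?thesis
    using f by (simp add: box_hom_def)
qed (simp add: box_hom_def)

lemma box_Mor_iff: "(B, f, A) \<in> Mor (box_sgs R) \<longleftrightarrow> A \<in> box_Ob R \<and> B \<in> box_Ob R \<and>
    f \<in> Hom R (fst B) (fst A) \<and> (\<lambda>x. Act R f ` inv_set R x) ` snd A = inv_set R ` snd B"
  by (simp add: box_sgs_def box_hom_iff cong: conj_cong)

lemma box_Hom_iff: "m \<in> Hom (box_sgs R) B A \<longleftrightarrow> (\<exists>f. m = (B, f, A) \<and> A \<in> box_Ob R \<and> B \<in> box_Ob R \<and>
    f \<in> Hom R (fst B) (fst A) \<and> (\<lambda>x. Act R f ` inv_set R x) ` snd A = inv_set R ` snd B)"
proof -
  have "m \<in> Hom (box_sgs R) B A \<longleftrightarrow> (\<exists>f. m = (B, f, A) \<and> (B, f, A) \<in> Mor (box_sgs R))"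
    by (cases m) (auto simp: Hom_def)
  then show ?thesis
    by (simp add: box_Mor_iff)
qed

lemma box_Ob_Ob: "A \<in> box_Ob R \<Longrightarrow> fst A \<in> Ob R"
  and box_Ob_Star: "\<lbrakk>A \<in> box_Ob R; x \<in> snd A\<rbrakk> \<Longrightarrow> x \<in> Star R (fst A)"
  by (auto simp: box_Ob_def)

lemma box_Ident_closed:
  assumes "A \<in> box_Ob R"
  shows "Ident (box_sgs R) A \<in> Hom (box_sgs R) A A"
proof -
  have "Act R (Ident R (fst A)) ` inv_set R x = inv_set R x" if "x \<in> snd A" for x
    using inv_set_eq[OF box_Ob_Star[OF assms that]] sinv_set_subset_Phi[OF box_Ob_Star[OF assms that]]
      Act_Ident[OF box_Ob_Ob[OF assms]] by (force simp: subset_iff)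
  then show ?thesis
    using assms Ident_closed[OF box_Ob_Ob[OF assms]] by (simp add: box_Hom_iff)
qed

lemma box_Comp_closed:
  assumes "m \<in> Hom (box_sgs R) C B" "n \<in> Hom (box_sgs R) B A"
  shows "Comp (box_sgs R) m n \<in> Hom (box_sgs R) C A"
proof -
  obtain f where f: "m = (C, f, B)" "B \<in> box_Ob R" "C \<in> box_Ob R" "f \<in> Hom R (fst C) (fst B)"
      "(\<lambda>x. Act R f ` inv_set R x) ` snd B = inv_set R ` snd C"
    using assms(1) by (auto simp: box_Hom_iff)
  obtain g where g: "n = (B, g, A)" "A \<in> box_Ob R" "g \<in> Hom R (fst B) (fst A)"
      "(\<lambda>x. Act R g ` inv_set R x) ` snd A = inv_set R ` snd B"
    using assms(2) by (auto simp: box_Hom_iff)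
  have "(\<lambda>x. Act R (f \<cdot> g) ` inv_set R x) ` snd A = (\<lambda>x. Act R f ` Act R g ` inv_set R x) ` snd A"
    by (rule image_cong[OF refl]) (rule image_inv_set_Comp[OF f(4) g(3) box_Ob_Star[OF g(2)]])
  also have "\<dots> = (\<lambda>S. Act R f ` S) ` (\<lambda>x. Act R g ` inv_set R x) ` snd A"
    by (simp only: image_image)
  also have "\<dots> = inv_set R ` snd C"
    unfolding g(4) f(5)[symmetric] by (simp add: image_image)
  finally show ?thesis
    using f g Comp_closed[OF f(4) g(3)] by (simp add: box_Hom_iff)
qed

lemma box_Inv_closed:
  assumes "m \<in> Hom (box_sgs R) B A"
  shows "Inv (box_sgs R) m \<in> Hom (box_sgs R) A B"
proof -
  obtain f where f: "m = (B, f, A)" "A \<in> box_Ob R" "B \<in> box_Ob R" "f \<in> Hom R (fst B) (fst A)"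
      "(\<lambda>x. Act R f ` inv_set R x) ` snd A = inv_set R ` snd B"
    using assms by (auto simp: box_Hom_iff)
  have "(\<lambda>y. Act R (Inv R f) ` inv_set R y) ` snd B = (\<lambda>S. Act R (Inv R f) ` S) ` inv_set R ` snd B"
    by (simp add: image_image)
  also have "\<dots> = (\<lambda>x. Act R (Inv R f) ` Act R f ` inv_set R x) ` snd A"
    unfolding f(5)[symmetric] by (simp add: image_image)
  also have "\<dots> = inv_set R ` snd A"
    by (intro image_cong refl image_inv_set_Inv[OF f(4) box_Ob_Star[OF f(2)] refl])
  finally show ?thesis
    using f Inv_closed[OF f(4)] by (simp add: box_Hom_iff)
qed

lemma box_signed_groupoid_set: "signed_groupoid_set (box_sgs R)"
proof (intro signed_groupoid_set.intro groupoid.intro signed_groupoid_set_axioms.intro)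
  show "Dom (box_sgs R) m \<in> Ob (box_sgs R)" "Cod (box_sgs R) m \<in> Ob (box_sgs R)"
    if "m \<in> Mor (box_sgs R)" for m
    using that by (cases m; simp add: box_Mor_iff)+
  show "definitely_involuted_set (Phi (box_sgs R) A) (Neg (box_sgs R) A) (Phi_pos (box_sgs R) A)"
    if "A \<in> Ob (box_sgs R)" for A
    using Phi_involuted box_Ob_Ob that by simp
  show "Ident (box_sgs R) A \<in> Hom (box_sgs R) A A" if "A \<in> Ob (box_sgs R)" for A
    using box_Ident_closed that by (simp del: box_simps(5))
qed (simp_all add: box_Comp_closed box_Inv_closed,
     auto simp: box_Hom_iff Comp_assoc Ident_left Ident_right Inv_left Inv_right
       Act_closed Act_Ident Act_Comp Act_Neg box_Ob_Ob)

lemma box_faithful_sgs: "faithful_sgs (box_sgs R)"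
proof -
  interpret B: signed_groupoid_set "box_sgs R"
    by (rule box_signed_groupoid_set)
  show ?thesis
  proof
    fix m assume m: "m \<in> Mor (box_sgs R)" and e: "inv_set (box_sgs R) m = {}"
    obtain B f A where mf: "m = (B, f, A)"
      by (cases m)
    then have f: "A \<in> box_Ob R" "B \<in> box_Ob R" "f \<in> Hom R (fst B) (fst A)"
        "(\<lambda>x. Act R f ` inv_set R x) ` snd A = inv_set R ` snd B"
      using m by (auto simp: box_Mor_iff)
    have fM: "f \<in> Mor R"
      using f(3) by (simp add: Hom_def)
    moreover have "inv_set R f = {}"
      using e f(3) mf by simp
    ultimately obtain c where c: "c \<in> Ob R" "f = Ident R c"
      using faithful by blast
    then have ca: "fst A = c" "fst B = c"
      using f(3) Ident_closed[OF c(1)] by (auto simp: Hom_def)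
    \<comment> \<open>It is not enough that \<open>f\<close> is an identity of \<open>R\<close>:
      domain and codomain in the box must agree. The trivial action equates the two families of
      inversion sets, and injectivity then equates the sets of morphisms.\<close>
    have "inv_set R x \<subseteq> Phi R c" if "x \<in> snd A" for x
      using inv_set_eq sinv_set_subset_Phi box_Ob_Star[OF f(1) that] ca by blast
    then have "Act R f ` inv_set R x = inv_set R x" if "x \<in> snd A" for x
      using that c Act_Ident[OF c(1)] by (force simp: subset_iff)
    then have "inv_set R ` snd A = inv_set R ` snd B"
      using f(4) by simp
    moreover have "inj_on (inv_set R) (Star R c)"
      using inv_set_inj by (meson inj_onI)
    moreover have "snd A \<subseteq> Star R c" "snd B \<subseteq> Star R c"
      using f(1,2) ca by (auto simp: box_Ob_def)
    ultimately have "snd A = snd B"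
      by (simp add: inj_on_image_eq_iff)
    then have "A = B"
      using ca by (simp add: prod_eq_iff)
    then show "\<exists>A \<in> Ob (box_sgs R). m = Ident (box_sgs R) A"
      using f(1) mf c ca by auto
  qed
qed

section \<open>Weak orders of the box\<close>

lemma box_StarE:
  assumes m: "m \<in> Star (box_sgs R) (b, Y)"
  obtains f A where "m = ((b, Y), f, A)" "f \<in> Star R b" "\<And>y. y \<in> Y \<Longrightarrow> independent R b f y"
    "sinv_set (box_sgs R) m = sinv_set R f"
proof -
  obtain f A where mf: "m = ((b, Y), f, A)"
    using m by (cases m) (auto simp: Star_def)
  have f: "A \<in> box_Ob R" "(b, Y) \<in> box_Ob R" "f \<in> Hom R b (fst A)"
      "(\<lambda>x. Act R f ` inv_set R x) ` snd A = inv_set R ` Y"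
    using m mf box_Mor_iff[of "(b, Y)" f A] by (auto simp: Star_def)
  have "independent R b f y" if y: "y \<in> Y" for y
  proof -
    obtain x where "x \<in> snd A" "Act R f ` inv_set R x = inv_set R y"
      using f(4) y by (metis (no_types, lifting) imageE image_eqI)
    moreover have "y \<in> Star R b"
      using box_Ob_Star[OF f(2)] y by simp
    ultimately show ?thesis
      using independent_iff[OF f(3)] box_Ob_Star[OF f(1)] by blast
  qed
  then show ?thesis
    using that[OF mf Hom_imp_Star[OF f(3)]] mf f(3) by simp
qed

text \<open>The domain is obtained by pulling \<open>Y\<close> back along \<open>f\<close>;
  independence provides a preimage of every \<open>y\<close>, so the whole of \<open>Y\<close> is
  reached.\<close>

lemma box_StarI:
  assumes ob: "(b, Y) \<in> box_Ob R" and f: "f \<in> Star R b" and ind: "\<And>y. y \<in> Y \<Longrightarrow> independent R b f y"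
  obtains A where "((b, Y), f, A) \<in> Star (box_sgs R) (b, Y)"
proof -
  let ?a = "Dom R f"
  let ?X = "{x \<in> Star R ?a. Act R f ` inv_set R x \<in> inv_set R ` Y}"
  have fH: "f \<in> Hom R b ?a"
    using f by (simp add: Star_iff_Hom)
  have "inv_set R y \<in> (\<lambda>x. Act R f ` inv_set R x) ` ?X" if y: "y \<in> Y" for y
  proof -
    have "y \<in> Star R b"
      using box_Ob_Star[OF ob] y by simp
    then obtain x where "x \<in> Star R ?a" "Act R f ` inv_set R x = inv_set R y"
      using independent_iff[OF fH] ind[OF y] by blast
    then show ?thesis
      using y by (intro image_eqI[of _ _ x]) auto
  qed
  then have "(\<lambda>x. Act R f ` inv_set R x) ` ?X = inv_set R ` Y"
    by auto
  moreover have "(?a, ?X) \<in> box_Ob R"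
    using Hom_Ob[OF fH] by (auto simp: box_Ob_def)
  ultimately have "((b, Y), f, (?a, ?X)) \<in> Mor (box_sgs R)"
    using ob fH by (simp add: box_Mor_iff)
  then have "((b, Y), f, (?a, ?X)) \<in> Star (box_sgs R) (b, Y)"
    by (simp add: Star_def)
  then show ?thesis
    by (rule that)
qed

end

lemma (in finite_sgs) finite_Ob: "finite (Ob R)"
proof -
  have "Ob R \<subseteq> Cod R ` Mor R"
    using Ident_closed by (force simp: Hom_def)
  then show ?thesis
    using finite_Mor finite_subset by blast
qed

text \<open>Independence survives joins, so the join formed in \<open>R\<close> already underlies a
  morphism of the box. Its being a join in \<open>R\<close> is recorded as well, for comparison with
  morphisms of \<open>R\<close> outside the box.\<close>

lemma (in complete_sgs) box_join_exists:
  assumes ob: "(b, Y) \<in> box_Ob R" and M: "M \<subseteq> Star (box_sgs R) (b, Y)"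
  obtains F A where "is_join (box_sgs R) (b, Y) M ((b, Y), F, A)" "is_join R b ((fst \<circ> snd) ` M) F"
    "(fst \<circ> snd) ` M \<subseteq> Star R b"
proof -
  let ?N = "(fst \<circ> snd) ` M"
  have N: "f \<in> Star R b \<and> (\<forall>y \<in> Y. independent R b f y)" if "f \<in> ?N" for f
    using that M by (auto elim!: box_StarE dest!: subsetD)
  then have NS: "?N \<subseteq> Star R b"
    by blast
  obtain F where F: "is_join R b ?N F"
    using join_exists[OF _ NS] box_Ob_Ob[OF ob] by auto
  have FS: "F \<in> Star R b"
    using F by (simp add: is_join_def)
  have "independent R b F y" if "y \<in> Y" for y
    by (rule independent_join[OF F NS]) (use N box_Ob_Star[OF ob] that in auto)
  then obtain A where A: "((b, Y), F, A) \<in> Star (box_sgs R) (b, Y)"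
    using box_StarI[OF ob FS] by blast
  have eq: "sinv_set (box_sgs R) m = sinv_set R (fst (snd m)) \<and> fst (snd m) \<in> Star R b"
    if "m \<in> Star (box_sgs R) (b, Y)" for m
    using box_StarE[OF that] by (metis fst_conv snd_conv)
  have "is_join (box_sgs R) (b, Y) M ((b, Y), F, A)"
    unfolding is_join_def
  proof (intro conjI ballI)
    fix k assume k: "k \<in> Star (box_sgs R) (b, Y)"
    have "(\<forall>h \<in> M. sinv_set (box_sgs R) h \<subseteq> sinv_set (box_sgs R) k) \<longleftrightarrow>
        (\<forall>h \<in> ?N. sinv_set R h \<subseteq> sinv_set R (fst (snd k)))"
      using eq[OF k] eq subsetD[OF M] by simp
    then show "sinv_set (box_sgs R) ((b, Y), F, A) \<subseteq> sinv_set (box_sgs R) k \<longleftrightarrow>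
        (\<forall>h \<in> M. sinv_set (box_sgs R) h \<subseteq> sinv_set (box_sgs R) k)"
      using F eq[OF k] eq[OF A] by (simp add: is_join_def)
  qed (rule A)
  then show ?thesis
    using that F NS by blast
qed

lemma (in complete_sgs) box_complete_sgs: "complete_sgs (box_sgs R)"
proof -
  interpret B: faithful_sgs "box_sgs R"
    by (rule box_faithful_sgs)
  show ?thesis
  proof (intro complete_sgs.intro complete_sgs_axioms.intro B.faithful_sgs_axioms)
    fix B assume "B \<in> Ob (box_sgs R)"
    then show "complete_lattice (weak_order (box_sgs R) B)"
      by (intro B.weak_order_completeI) (cases B, metis box_join_exists box_simps(1))
  qed
qed

text \<open>
  The box meet of \<open>s\<close> and \<open>g\<close> is the complement of the join of their complements. That join is also
  taken in \<open>R\<close>, so it stays disjoint from everything below both \<open>s\<close> and \<open>g\<close> in \<open>R\<close>.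
\<close>

lemma (in complete_sgs) box_lower_bound:
  assumes s: "s \<in> Star (box_sgs R) (b, Y)" and g: "g \<in> Star (box_sgs R) (b, Y)" and r: "r \<in> Star R b"
    and rs: "sinv_set R r \<subseteq> sinv_set (box_sgs R) s" and rg: "sinv_set R r \<subseteq> sinv_set (box_sgs R) g"
  obtains m where "m \<in> Star (box_sgs R) (b, Y)" "sinv_set R r \<subseteq> sinv_set (box_sgs R) m"
    "sinv_set (box_sgs R) m \<subseteq> sinv_set (box_sgs R) s"
    "sinv_set (box_sgs R) m \<subseteq> sinv_set (box_sgs R) g"
proof -
  interpret B: complete_sgs "box_sgs R"
    by (rule box_complete_sgs)
  let ?N = "sinv_set (box_sgs R)" and ?S = "Star (box_sgs R) (b, Y)"
  have ob: "(b, Y) \<in> box_Ob R"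
    using s B.Cod_closed[of s] by (simp add: Star_def)
  then obtain w where w: "is_top (box_sgs R) (b, Y) w"
    by (metis B.top_exists box_simps(1))
  have top: "?N h \<subseteq> ?N w" if "h \<in> ?S" for h
    using w that by (simp add: is_top_def)
  obtain s' where s': "s' \<in> ?S" "?N s' = ?N w - ?N s"
    using B.complement_exists[OF w s] by blast
  obtain g' where g': "g' \<in> ?S" "?N g' = ?N w - ?N g"
    using B.complement_exists[OF w g] by blast
  obtain F A where F: "is_join (box_sgs R) (b, Y) {s', g'} ((b, Y), F, A)"
      "is_join R b ((fst \<circ> snd) ` {s', g'}) F" "(fst \<circ> snd) ` {s', g'} \<subseteq> Star R b"
    using box_join_exists[OF ob, of "{s', g'}"] s'(1) g'(1) by blast
  let ?f = "((b, Y), F, A)"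
  have f: "?f \<in> ?S" "?N s' \<subseteq> ?N ?f" "?N g' \<subseteq> ?N ?f"
    using F(1) by (auto simp: is_join_def)
  have eq: "?N k = sinv_set R (fst (snd k))" if "k \<in> ?S" for k
    using box_StarE[OF that] by (metis fst_conv snd_conv)
  \<comment> \<open>As \<open>r\<close> need not underlie a morphism of the box, disjointness must
    be argued with the join in \<open>R\<close>.\<close>
  have dis: "sinv_set R F \<inter> sinv_set R r = {}"
  proof (rule join_disjoint[OF F(2,3) r])
    fix h assume "h \<in> (fst \<circ> snd) ` {s', g'}"
    then consider "h = fst (snd s')" | "h = fst (snd g')"
      by auto
    then show "sinv_set R h \<inter> sinv_set R r = {}"
      using eq[OF s'(1)] eq[OF g'(1)] s'(2) g'(2) rs rg by cases blast+
  qed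
  obtain m where m: "m \<in> ?S" "?N m = ?N w - ?N ?f"
    using B.complement_exists[OF w f(1)] by blast
  show ?thesis
  proof (rule that[OF m(1)])
    show "sinv_set R r \<subseteq> ?N m"
      using dis eq[OF f(1)] rs top[OF s] m(2) by auto
    show "?N m \<subseteq> ?N s" "?N m \<subseteq> ?N g"
      using m(2) f(2,3) s'(2) g'(2) by blast+
  qed
qed

section \<open>Finiteness and the atomic dichotomy for the box\<close>

theorem proposition3p15:
  fixes R :: "('o, 'm, 'r) sgs"
  assumes "faithful_sgs R"
    and "finite_sgs R"
    and "complete_sgs R"
    and "preprincipal_sgs R"
  shows "finite_sgs (box_sgs R) \<and> complete_sgs (box_sgs R) \<and> preprincipal_sgs (box_sgs R)"
proof -
  interpret finite_sgs R by fact
  interpret complete_sgs R by fact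
  interpret preprincipal_sgs R by fact
  interpret B: complete_sgs "box_sgs R"
    by (rule box_complete_sgs)
  let ?N = "sinv_set (box_sgs R)"
  have "Star R b \<subseteq> Mor R" for b
    by (auto simp: Star_def)
  then have "box_Ob R \<subseteq> Ob R \<times> Pow (Mor R)"
    by (auto simp: box_Ob_def)
  then have "finite (box_Ob R)"
    using finite_subset finite_Ob finite_Mor by blast
  moreover have "Mor (box_sgs R) \<subseteq> box_Ob R \<times> Mor R \<times> box_Ob R"
    using box_Mor_iff by (auto simp: Hom_def)
  ultimately have fin: "finite (Mor (box_sgs R))"
    using finite_Mor by (meson finite_SigmaI finite_subset)
  have "finite_sgs (box_sgs R)"
    by unfold_locales (use fin finite_Phi box_Ob_Ob in auto)
  moreover have "preprincipal_sgs (box_sgs R)"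
  proof
    have "finite {h \<in> Star (box_sgs R) B. P h}" for B P
      by (rule finite_subset[OF _ fin]) (auto simp: Star_def)
    then show "interval_finite (box_sgs R)"
      by (simp add: interval_finite_def)
  next
    fix B g s
    assume B: "B \<in> Ob (box_sgs R)" and g: "g \<in> Star (box_sgs R) B"
      and s: "s \<in> Star (box_sgs R) B" and at: "atomic (box_sgs R) s"
    obtain b Y where BY: "B = (b, Y)"
      by (cases B)
    note g = g[unfolded BY] and s = s[unfolded BY]
    have ne: "?N s \<noteq> {}" and min: "\<And>k. \<lbrakk>k \<in> Star (box_sgs R) (b, Y); ?N k \<subseteq> ?N s; ?N k \<noteq> {}\<rbrakk>
        \<Longrightarrow> ?N k = ?N s"
      using at B.atomic_iff[OF s] by auto
    obtain s0 where s0: "s0 \<in> Star R b" "?N s = sinv_set R s0"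
      using box_StarE[OF s] by metis
    obtain g0 where g0: "g0 \<in> Star R b" "?N g = sinv_set R g0"
      using box_StarE[OF g] by metis
    \<comment> \<open>The morphism under \<open>s\<close> need not be an atom of \<open>R\<close>;
      the dichotomy of \<open>R\<close> is applied to an atom \<open>r\<close> below it.\<close>
    obtain r where r: "r \<in> Star R b" "atomic R r" "sinv_set R r \<subseteq> ?N s"
      using atomic_below[OF s0(1)] ne s0(2) by metis
    have rne: "sinv_set R r \<noteq> {}"
      using r(2) atomic_iff[OF r(1)] by blast
    \<comment> \<open>A lower bound of \<open>s\<close> and \<open>h\<close> in the box that stays
      above \<open>r\<close> is nontrivial, so it has the inversion set of the atom
      \<open>s\<close>.\<close>
    have below: "?N s \<subseteq> ?N h" if h: "h \<in> Star (box_sgs R) (b, Y)" "sinv_set R r \<subseteq> ?N h" for h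
    proof -
      obtain m where m: "m \<in> Star (box_sgs R) (b, Y)" "sinv_set R r \<subseteq> ?N m" "?N m \<subseteq> ?N s" "?N m \<subseteq> ?N h"
        using box_lower_bound[OF s h(1) r(1,3) h(2)] .
      then have "?N m = ?N s"
        using min rne by blast
      then show ?thesis
        using m(4) by simp
    qed
    have "b \<in> Ob R"
      using box_Ob_Ob[of B] B BY by simp
    then consider "sinv_set R r \<subseteq> ?N g" | "sinv_set R r \<inter> ?N g = {}"
      using atomic_dichotomy[OF _ g0(1) r(1,2)] inv_set_subset_iff[OF r(1) g0(1)]
        inv_set_disjoint_iff[OF r(1) g0(1)] g0(2) by auto
    then show "inv_set (box_sgs R) s \<subseteq> inv_set (box_sgs R) g \<or>
        inv_set (box_sgs R) s \<inter> inv_set (box_sgs R) g = {}"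
    proof cases
      case 1
      then show ?thesis
        using below[OF g] B.inv_set_subset_iff[OF s g] by blast
    next
      case 2
      obtain w where w: "is_top (box_sgs R) (b, Y) w"
        using B.top_exists B BY by blast
      then have "?N s \<subseteq> ?N w"
        using s by (simp add: is_top_def)
      moreover obtain g' where g': "g' \<in> Star (box_sgs R) (b, Y)" "?N g' = ?N w - ?N g"
        using B.complement_exists[OF w g] by blast
      \<comment> \<open>Being below \<open>s\<close>, \<open>r\<close> lies below \<open>w\<close>;
        as it also avoids \<open>g\<close>, it lies below the complement \<open>g'\<close>, and
        \<open>below\<close> lifts this to \<open>s\<close>.\<close>
      ultimately have "?N s \<subseteq> ?N g'"
        using below[OF g'(1)] r(3) 2 by blast
      then show ?thesis
        using g'(2) B.inv_set_disjoint_iff[OF s g] by blast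
    qed
  qed
  ultimately show ?thesis
    using B.complete_sgs_axioms by blast
qed

end
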